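(* Let $G=(V,E)$ be a digraph with energy $\mathcal{E}(G)$ and Randić index $R(G)$. Then $\mathcal{E}(G)\geq 2R(G)$.
   Context: A digraph is a pair $G=(V,E)$ with $V=\{v_1,\dots,v_n\}$ a finite set and $E\subset V\times V$ such that $(v,v)\notin E$ for all $v\in V$ (both $(v,w)$ and $(w,v)$ may belong to $E$). Its adjacency matrix $A$ is the $n\times n$ matrix with $A_{ij}=1$ if $(v_i,v_j)\in E$ and $A_{ij}=0$ otherwise. The energy of $G$ is $\mathcal{E}(G)=\mathrm{Tr}((AA^t)^{1/2})=\mathrm{Tr}((A^tA)^{1/2})$, i.e. the sum of the singular values of $A$ counted with multiplicity. For $v\in V$, the outer degree is $d^+(v)=|\{w\in V:(v,w)\in E\}|$ and the inner degree is $d^-(v)=|\{w\in V:(w,v)\in E\}|$. The Randić index of $G$ is $$R(G)=\frac{1}{2}\sum_{(v,w)\in E}\frac{1}{\sqrt{d^+(v)\,d^-(w)}}.$$ *)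

theory Defs
  imports Complex_Main "Graph_Theory.Pair_Digraph" "Jordan_Normal_Form.Matrix"
begin

text \<open>
  Finite loopless digraphs without parallel arcs (arcs in both directions between two vertices
  being allowed) are the locale \<^locale>\<open>pair_digraph\<close>. Matrices are taken with respect to an
  enumeration \<open>vs\<close> of the vertices, a list without repetitions.
\<close>

definition adj_mat :: "'a pair_pre_digraph \<Rightarrow> 'a list \<Rightarrow> real mat" where
  "adj_mat G vs = mat (length vs) (length vs)
     (\<lambda>(i, j). if (vs ! i, vs ! j) \<in> parcs G then 1 else 0)"

definition mat_trace :: "real mat \<Rightarrow> real" where
  "mat_trace M = (\<Sum>i<dim_row M. M $$ (i, i))"

text \<open>Over the reals, symmetry does not follow from nonnegativity of the quadratic form.\<close>

definition psd_mat :: "nat \<Rightarrow> real mat \<Rightarrow> bool" where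
  "psd_mat n S \<longleftrightarrow> S \<in> carrier_mat n n \<and> transpose_mat S = S \<and>
     (\<forall>x \<in> carrier_vec n. 0 \<le> x \<bullet> (S *\<^sub>v x))"

text \<open>
  The principal square root \<open>M\<^sup>1\<^sup>/\<^sup>2\<close>; a positive semidefinite \<open>M\<close> has exactly one positive
  semidefinite square root, so the description is proper for such \<open>M\<close>.
\<close>

definition mat_sqrt :: "real mat \<Rightarrow> real mat" where
  "mat_sqrt M = (THE S. psd_mat (dim_row M) S \<and> S * S = M)"

definition energy :: "'a pair_pre_digraph \<Rightarrow> 'a list \<Rightarrow> real" where
  "energy G vs = mat_trace (mat_sqrt (adj_mat G vs * transpose_mat (adj_mat G vs)))"

definition randic_index :: "'a pair_pre_digraph \<Rightarrow> real" where
  "randic_index G = 1 / 2 *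
     (\<Sum>(v, w) \<in> parcs G. 1 / sqrt (real (out_degree G v) * real (in_degree G w)))"

end

(* Let A be the adjacency matrix and B the matrix with entries A_ij / sqrt (d+(v_i) d-(v_j)).
   Then 2 R(G) = Tr (A B^t). By Cauchy-Schwarz (the Schur test) B^t is a contraction. Computing the
   trace in an orthonormal eigenbasis u_i of S = (A A^t)^(1/2), with eigenvalues s_i, gives
   Tr (A B^t) = sum of (A^t u_i) . (B^t u_i), and each term is at most |A^t u_i| = s_i, so that
   Tr (A B^t) <= Tr S. *)

theory Submission
  imports Defs "Jordan_Normal_Form.Schur_Decomposition" "HOL-Analysis.L2_Norm"
begin

section \<open>Spectral theorem for real symmetric matrices\<close>

text \<open>The characteristic polynomial has a complex root, and symmetry forces that root to be
  real. A real root of the characteristic polynomial of \<open>A\<close> is then an eigenvalue over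
  the reals.\<close>

lemma symmetric_mat_eigenvalue:
  fixes A :: "real mat"
  assumes A: "A \<in> carrier_mat n n" and sym: "A\<^sup>T = A" and n: "n > 0"
  shows "\<exists>e. eigenvalue A e"
proof -
  let ?C = "map_mat complex_of_real A"
  have C: "?C \<in> carrier_mat n n" using A by simp
  have symC: "?C\<^sup>T = ?C" using sym by (simp add: map_mat_transpose)
  have "degree (char_poly ?C) = n" using degree_monic_char_poly[OF C] by blast
  then have "\<not> constant (poly (char_poly ?C))" using n by (simp add: constant_degree)
  then obtain l where l: "poly (char_poly ?C) l = 0"
    using fundamental_theorem_of_algebra by blast
  then obtain z where "eigenvector ?C z l"
    using eigenvalue_root_char_poly[OF C] unfolding eigenvalue_def by blast
  then have z: "z \<in> carrier_vec n" and z0: "z \<noteq> 0\<^sub>v n" and Cz: "?C *\<^sub>v z = l \<cdot>\<^sub>v z"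
    using C unfolding eigenvector_def by auto
  have cz: "conjugate z \<in> carrier_vec n" using z by simp
  have Ccz: "?C *\<^sub>v conjugate z = conjugate (?C *\<^sub>v z)"
    using A z by (intro eq_vecI) (auto simp: scalar_prod_def)
  \<comment> \<open>The product is bilinear, without a hidden conjugation, so symmetry moves
    \<open>?C\<close> to the other factor. As \<open>?C\<close> has real entries, it acts on
    \<open>conjugate z\<close> with eigenvalue \<open>cnj l\<close>; finally
    \<open>z \<bullet> conjugate z\<close> is nonzero and cancels.\<close>
  have "l * (z \<bullet> conjugate z) = (?C *\<^sub>v z) \<bullet> conjugate z"
    using z cz Cz by simp
  also have "\<dots> = z \<bullet> (?C *\<^sub>v conjugate z)"
    using transpose_vec_mult_scalar[OF C cz z] symC by simp
  also have "\<dots> = cnj l * (z \<bullet> conjugate z)"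
    unfolding Ccz Cz using z cz by (simp add: conjugate_smult_vec)
  finally have "l = cnj l"
    using z z0 by simp
  then have "l = complex_of_real (Re l)"
    by (metis Reals_cnj_iff of_real_Re)
  with l have "complex_of_real (poly (char_poly A) (Re l)) = 0"
    unfolding of_real_hom.char_poly_hom[OF A] by (metis of_real_hom.poly_map_poly)
  then have "poly (char_poly A) (Re l) = 0" by simp
  then show ?thesis using eigenvalue_root_char_poly[OF A] by blast
qed

text \<open>Complete \<open>v\<close> to a basis and orthogonalize: Gram-Schmidt keeps the first
  vector, so the first column is \<open>v\<close> up to the normalizing factor \<open>c\<close>.
  This supplies the change of basis that splits off one eigenvector.\<close>

lemma orthogonal_mat_with_first_col:
  fixes v :: "real vec"
  assumes v: "v \<in> carrier_vec n" and v0: "v \<noteq> 0\<^sub>v n"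
  obtains W c where "W \<in> carrier_mat n n" "W\<^sup>T * W = 1\<^sub>m n" "col W 0 = c \<cdot>\<^sub>v v"
proof -
  interpret cof_vec_space n "TYPE(real)" .
  define b where "b = basis_completion v"
  define ws where "ws = gram_schmidt n b"
  note b = basis_completion[OF v v0, folded b_def]
  have ws: "set ws \<subseteq> carrier_vec n" "corthogonal ws" "length ws = n"
    using gram_schmidt_result[OF b(2) b(4) b(5) ws_def] b(6) by auto
  have n: "n > 0" using v v0 by (cases n) auto
  have "b = v # tl b" using b(6,7) n by (cases b) auto
  then have hd: "ws ! 0 = v"
    using gram_schmidt_hd[OF v, of "tl b"] ws(3) n unfolding ws_def by (metis hd_conv_nth length_0_conv neq0_conv)
  \<comment> \<open>Gram-Schmidt only makes the vectors orthogonal; their lengths are normalized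
    here.\<close>
  define us where "us = map (\<lambda>w. (1 / sqrt (w \<bullet> w)) \<cdot>\<^sub>v w) ws"
  define W where "W = mat_of_cols n us"
  have wsn: "ws ! i \<in> carrier_vec n" if "i < n" for i using ws that by auto
  have us: "us ! i = (1 / sqrt (ws ! i \<bullet> ws ! i)) \<cdot>\<^sub>v ws ! i" if "i < n" for i
    using that ws(3) by (simp add: us_def)
  have W: "W \<in> carrier_mat n n" 
    using mat_of_cols_carrier(1)[of n us] ws(3) unfolding W_def by (simp add: us_def)
  have colW: "col W i = us ! i" if "i < n" for i
    unfolding W_def using that ws(3) wsn us by (intro col_mat_of_cols) (auto simp: us_def)
  have "W\<^sup>T * W = 1\<^sub>m n"
  proof (rule eq_matI)
    fix i j assume "i < dim_row (1\<^sub>m n :: real mat)" "j < dim_col (1\<^sub>m n :: real mat)"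
    then have i: "i < n" and j: "j < n" by auto
    have "(W\<^sup>T * W) $$ (i, j) = us ! i \<bullet> us ! j"
      using W i j by (simp add: colW)
    also have "\<dots> = (ws ! i \<bullet> ws ! j) / (sqrt (ws ! i \<bullet> ws ! i) * sqrt (ws ! j \<bullet> ws ! j))"
      using i j wsn[OF i] wsn[OF j] by (simp add: us)
    also have "\<dots> = 1\<^sub>m n $$ (i, j)"
    proof (cases "i = j")
      case True
      have "0 \<le> ws ! i \<bullet> ws ! i" using conjugate_square_ge_0_vec[of "ws ! i"] by simp
      moreover have "ws ! i \<bullet> ws ! i \<noteq> 0" using corthogonalD[OF ws(2), of i i] i ws(3) by simp
      ultimately show ?thesis using True i by simp
    next
      case False
      then have "ws ! i \<bullet> ws ! j = 0" using corthogonalD[OF ws(2), of i j] i j ws(3) by simp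
      then show ?thesis using False i j by simp
    qed
    finally show "(W\<^sup>T * W) $$ (i, j) = 1\<^sub>m n $$ (i, j)" .
  qed (use W in auto)
  moreover have "col W 0 = (1 / sqrt (v \<bullet> v)) \<cdot>\<^sub>v v"
    using colW[OF n] us[OF n] hd by simp
  ultimately show ?thesis using that W by blast
qed

definition diagonal :: "nat \<Rightarrow> (nat \<Rightarrow> real) \<Rightarrow> real mat" where
  "diagonal n d = mat n n (\<lambda>(i, j). if i = j then d i else 0)"

lemma diagonal_carrier [simp]: "diagonal n d \<in> carrier_mat n n"
  by (simp add: diagonal_def)

lemma diagonal_index [simp]:
  "i < n \<Longrightarrow> j < n \<Longrightarrow> diagonal n d $$ (i, j) = (if i = j then d i else 0)"
  by (simp add: diagonal_def)

lemma diagonal_dim [simp]: "dim_row (diagonal n d) = n" "dim_col (diagonal n d) = n"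
  by (simp_all add: diagonal_def)

lemma transpose_diagonal [simp]: "(diagonal n d)\<^sup>T = diagonal n d"
  by (rule eq_matI) auto

lemma col_mult_diagonal:
  assumes "U \<in> carrier_mat m n" "i < n"
  shows "col (U * diagonal n d) i = d i \<cdot>\<^sub>v col U i"
  using assms by (intro eq_vecI) (auto simp: scalar_prod_def if_distrib mult.commute cong: if_cong)

lemma diagonal_mult_diagonal: "diagonal n c * diagonal n d = diagonal n (\<lambda>i. c i * d i)"
  by (rule eq_matI) (auto simp: scalar_prod_def if_distrib cong: if_cong)

text \<open>Induction by deflation: in an orthonormal basis that starts with an eigenvector, the
  matrix splits into a 1 by 1 block and a symmetric block of size \<open>m\<close>. The equation
  \<open>A * U = U * diagonal n d\<close> says column by column that the columns of \<open>U\<close>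
  are eigenvectors, the form in which it is used later.\<close>

theorem symmetric_mat_diagonalization:
  fixes A :: "real mat"
  assumes "A \<in> carrier_mat n n" "A\<^sup>T = A"
  obtains U d where "U \<in> carrier_mat n n" "U\<^sup>T * U = 1\<^sub>m n" "A * U = U * diagonal n d"
  using assms
proof (induction n arbitrary: A thesis)
  case 0
  show ?case by (rule "0.prems"(1)[of "1\<^sub>m 0"]) (use "0.prems" in auto)
next
  case (Suc m)
  let ?n = "Suc m"
  note A = Suc.prems(2) and sym = Suc.prems(3)
  obtain e v where ev: "eigenvector A v e"
    using symmetric_mat_eigenvalue[OF A sym] unfolding eigenvalue_def by auto
  then have v: "v \<in> carrier_vec ?n" "v \<noteq> 0\<^sub>v ?n" and Av: "A *\<^sub>v v = e \<cdot>\<^sub>v v"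
    using A unfolding eigenvector_def by auto
  obtain W c where W: "W \<in> carrier_mat ?n ?n" and WW: "W\<^sup>T * W = 1\<^sub>m ?n"
    and W0: "col W 0 = c \<cdot>\<^sub>v v"
    using orthogonal_mat_with_first_col[OF v] by blast
  have WT: "W\<^sup>T \<in> carrier_mat ?n ?n" using W by simp
  have WW': "W * W\<^sup>T = 1\<^sub>m ?n" by (rule mat_mult_left_right_inverse[OF WT W WW])
  define A' where "A' = W\<^sup>T * (A * W)"
  have AW: "A * W \<in> carrier_mat ?n ?n" using A W by simp
  have A': "A' \<in> carrier_mat ?n ?n" unfolding A'_def using WT AW by simp
  have symA': "A'\<^sup>T = A'"
    unfolding A'_def transpose_mult[OF WT AW] transpose_mult[OF A W]
    using A W WT sym by simp
  have c0: "col W 0 \<in> carrier_vec ?n" unfolding W0 using v by simp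
  \<comment> \<open>The first column of \<open>W\<close> is an eigenvector of \<open>A\<close>, and
    \<open>W\<^sup>T\<close> maps it to the first unit vector.\<close>
  have "col A' 0 = W\<^sup>T *\<^sub>v (A *\<^sub>v col W 0)"
    unfolding A'_def using col_mult2[OF WT AW, of 0] col_mult2[OF A W, of 0] by simp
  also have "A *\<^sub>v col W 0 = e \<cdot>\<^sub>v col W 0"
    unfolding W0 using A v Av by (simp add: mult_mat_vec[of _ ?n ?n] smult_smult_assoc mult.commute)
  also have "W\<^sup>T *\<^sub>v (e \<cdot>\<^sub>v col W 0) = e \<cdot>\<^sub>v (W\<^sup>T *\<^sub>v col W 0)"
    by (rule mult_mat_vec[OF WT c0])
  also have "W\<^sup>T *\<^sub>v col W 0 = col (1\<^sub>m ?n) 0"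
    using col_mult2[OF WT W, of 0] WW by simp
  finally have col0: "col A' 0 = e \<cdot>\<^sub>v col (1\<^sub>m ?n) 0" .
  have i0: "A' $$ (i, 0) = (if i = 0 then e else 0)" if "i < ?n" for i
    using arg_cong[OF col0, of "\<lambda>x. x $ i"] that A' by simp
  \<comment> \<open>Symmetry carries the zeros of the first column over to the first row.\<close>
  have oi: "A' $$ (0, i) = (if i = 0 then e else 0)" if "i < ?n" for i
    using i0[OF that] arg_cong[OF symA', of "\<lambda>X. X $$ (i, 0)"] that A' by simp
  define A3 where "A3 = mat m m (\<lambda>(i, j). A' $$ (Suc i, Suc j))"
  have A3: "A3 \<in> carrier_mat m m" unfolding A3_def by simp
  have "A' $$ (i, j) = A' $$ (j, i)" if "i < ?n" "j < ?n" for i j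
    using arg_cong[OF symA', of "\<lambda>X. X $$ (j, i)"] that A' by simp
  then have "A3\<^sup>T = A3" unfolding A3_def by (intro eq_matI) auto
  with A3 obtain V d where V: "V \<in> carrier_mat m m" and VV: "V\<^sup>T * V = 1\<^sub>m m"
    and AV: "A3 * V = V * diagonal m d"
    using Suc.IH by blast
  define E where "E = diagonal 1 (\<lambda>_. e)"
  define d' where "d' = (\<lambda>i. case i of 0 \<Rightarrow> e | Suc k \<Rightarrow> d k)"
  \<comment> \<open>\<open>U\<close> fixes the eigenvector already found and diagonalizes the
    remaining block; \<open>W * U\<close> returns to the original coordinates.\<close>
  define U where "U = four_block_mat (1\<^sub>m 1) (0\<^sub>m 1 m) (0\<^sub>m m 1) V"
  have E: "E \<in> carrier_mat 1 1" unfolding E_def by simp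
  have blockA: "A' = four_block_mat E (0\<^sub>m 1 m) (0\<^sub>m m 1) A3"
    using A' by (intro eq_matI) (auto simp: E_def A3_def i0 oi)
  have blockD: "diagonal ?n d' = four_block_mat E (0\<^sub>m 1 m) (0\<^sub>m m 1) (diagonal m d)"
    by (intro eq_matI) (auto simp: E_def d'_def split: nat.split)
  have U: "U \<in> carrier_mat ?n ?n" unfolding U_def using V by (metis four_block_carrier_mat one_carrier_mat plus_1_eq_Suc)
  have UT: "U\<^sup>T = four_block_mat (1\<^sub>m 1) (0\<^sub>m 1 m) (0\<^sub>m m 1) (V\<^sup>T)"
    unfolding U_def using V by (subst transpose_four_block_mat[of _ 1 1 _ m _ m]) auto
  have UU: "U\<^sup>T * U = 1\<^sub>m ?n"
    unfolding UT unfolding U_def using V VV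
    by (subst mult_four_block_mat[of _ 1 1 _ m _ m _ _ 1 _ m]) auto
  have "A' * U = four_block_mat E (0\<^sub>m 1 m) (0\<^sub>m m 1) (A3 * V)"
    unfolding blockA U_def using E V A3
    by (subst mult_four_block_mat[of _ 1 1 _ m _ m _ _ 1 _ m]) auto
  also have "\<dots> = U * diagonal ?n d'"
    unfolding blockD U_def AV using E V
    by (subst mult_four_block_mat[of _ 1 1 _ m _ m _ _ 1 _ m]) auto
  finally have A'U: "A' * U = U * diagonal ?n d'" .
  show ?case
  proof (rule Suc.prems(1)[of "W * U" d'])
    show "W * U \<in> carrier_mat ?n ?n" using W U by simp
    have UTc: "U\<^sup>T \<in> carrier_mat ?n ?n" using U by simp
    have WU: "W * U \<in> carrier_mat ?n ?n" using W U by simp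
    have "(W * U)\<^sup>T * (W * U) = U\<^sup>T * ((W\<^sup>T * W) * U)"
      unfolding transpose_mult[OF W U] assoc_mult_mat[OF UTc WT WU] assoc_mult_mat[OF WT W U] ..
    then show "(W * U)\<^sup>T * (W * U) = 1\<^sub>m ?n" using WW UU U by simp
    have "A * (W * U) = (W * W\<^sup>T) * (A * W * U)"
      unfolding WW' using A W U by simp
    also have "\<dots> = W * (A' * U)"
      unfolding A'_def assoc_mult_mat[OF W WT mult_carrier_mat[OF AW U]] assoc_mult_mat[OF WT AW U] ..
    also have "\<dots> = W * U * diagonal ?n d'" 
      unfolding A'U by (rule assoc_mult_mat[OF W U diagonal_carrier, symmetric])
    finally show "A * (W * U) = W * U * diagonal ?n d'" .
  qed
qed

section \<open>Inner products, traces and positive semidefinite matrices\<close>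

lemma real_scalar_prod_self_nonneg: "0 \<le> (x :: real vec) \<bullet> x"
  by (simp add: scalar_prod_def sum_nonneg)

lemma real_scalar_prod_self_eq_0: "x \<in> carrier_vec n \<Longrightarrow> (x :: real vec) \<bullet> x = 0 \<longleftrightarrow> x = 0\<^sub>v n"
  using conjugate_square_eq_0_vec[of x n] by simp

text \<open>Cauchy-Schwarz, reduced to the inequality for \<open>L2_set\<close> by taking absolute
  values termwise.\<close>

lemma scalar_prod_le_norm_mult:
  fixes x y :: "real vec"
  assumes "x \<in> carrier_vec n" "y \<in> carrier_vec n"
  shows "x \<bullet> y \<le> sqrt (x \<bullet> x) * sqrt (y \<bullet> y)"
proof -
  have "x \<bullet> y \<le> (\<Sum>i\<in>{0..<n}. \<bar>x $ i\<bar> * \<bar>y $ i\<bar>)"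
    using assms by (auto simp: scalar_prod_def abs_mult[symmetric] intro!: sum_mono)
  also have "\<dots> \<le> sqrt (x \<bullet> x) * sqrt (y \<bullet> y)"
    using L2_set_mult_ineq[of "\<lambda>i. x $ i" "\<lambda>i. y $ i" "{0..<n}"] assms
    by (simp add: scalar_prod_def L2_set_def power2_eq_square)
  finally show ?thesis .
qed

lemma mat_trace_mult_commute:
  assumes "X \<in> carrier_mat m n" "Y \<in> carrier_mat n m"
  shows "mat_trace (X * Y) = mat_trace (Y * X)"
proof -
  have "mat_trace (X * Y) = (\<Sum>i<m. \<Sum>j<n. X $$ (i, j) * Y $$ (j, i))"
    using assms by (simp add: mat_trace_def scalar_prod_def atLeast0LessThan)
  also have "\<dots> = (\<Sum>j<n. \<Sum>i<m. Y $$ (j, i) * X $$ (i, j))"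
    by (subst sum.swap) (simp add: mult.commute)
  also have "\<dots> = mat_trace (Y * X)"
    using assms by (simp add: mat_trace_def scalar_prod_def atLeast0LessThan)
  finally show ?thesis .
qed

text \<open>The quadratic form at \<open>x\<close> is the squared norm of
  \<open>X\<^sup>T *\<^sub>v x\<close>.\<close>

lemma psd_mat_mult_transpose:
  assumes X: "X \<in> carrier_mat n m"
  shows "psd_mat n (X * X\<^sup>T)"
proof -
  have XT: "X\<^sup>T \<in> carrier_mat m n" using X by simp
  have "0 \<le> x \<bullet> ((X * X\<^sup>T) *\<^sub>v x)" if x: "x \<in> carrier_vec n" for x
  proof -
    have "x \<bullet> ((X * X\<^sup>T) *\<^sub>v x) = (X\<^sup>T *\<^sub>v x) \<bullet> (X\<^sup>T *\<^sub>v x)"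
      using X XT x transpose_vec_mult_scalar[OF X _ x, of "X\<^sup>T *\<^sub>v x"] by simp
    then show ?thesis using real_scalar_prod_self_nonneg by simp
  qed
  then show ?thesis using X XT unfolding psd_mat_def by (simp add: transpose_mult[OF X XT])
qed

lemma orthogonal_mat_col_self:
  fixes U :: "real mat"
  assumes U: "U \<in> carrier_mat n n" "U\<^sup>T * U = 1\<^sub>m n" and i: "i < n"
  shows "col U i \<bullet> col U i = 1"
  using arg_cong[OF U(2), of "\<lambda>X. X $$ (i, i)"] U(1) i by simp

section \<open>The principal square root\<close>

text \<open>The source of uniqueness of the square root. For \<open>s > 0\<close> the operator
  \<open>T + s\<close> is injective, so it can be cancelled from
  \<open>(T + s) (T - s) u = 0\<close>. For \<open>s = 0\<close> this may fail, and symmetry is used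
  instead: the squared norm of \<open>T u\<close> is \<open>u \<bullet> T (T u) = 0\<close>.\<close>

lemma psd_mat_square_root_eigenvector:
  assumes T: "psd_mat n T" and u: "u \<in> carrier_vec n" and s: "s \<ge> 0"
    and TTu: "T *\<^sub>v (T *\<^sub>v u) = (s * s) \<cdot>\<^sub>v u"
  shows "T *\<^sub>v u = s \<cdot>\<^sub>v u"
proof -
  have Tc: "T \<in> carrier_mat n n" and sym: "T\<^sup>T = T"
    and pos: "\<And>x. x \<in> carrier_vec n \<Longrightarrow> 0 \<le> x \<bullet> (T *\<^sub>v x)"
    using T unfolding psd_mat_def by auto
  have Tu: "T *\<^sub>v u \<in> carrier_vec n" using Tc u by simp
  show ?thesis
  proof (cases "s = 0")
    case True
    have "(T *\<^sub>v u) \<bullet> (T *\<^sub>v u) = u \<bullet> (T *\<^sub>v (T *\<^sub>v u))"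
      using transpose_vec_mult_scalar[OF Tc Tu u] sym by simp
    also have "\<dots> = 0" unfolding TTu using True u by simp
    finally have "T *\<^sub>v u = 0\<^sub>v n" using real_scalar_prod_self_eq_0[OF Tu] by simp
    then show ?thesis using True u by auto
  next
    case False
    \<comment> \<open>\<open>T w = - s w\<close> by \<open>(T + s) (T - s) u = 0\<close>, so positivity of \<open>T\<close> forces \<open>w = 0\<close>.\<close>
    define w where "w = T *\<^sub>v u - s \<cdot>\<^sub>v u"
    have w: "w \<in> carrier_vec n" unfolding w_def using Tu u by simp
    have "T *\<^sub>v w = T *\<^sub>v (T *\<^sub>v u) - s \<cdot>\<^sub>v (T *\<^sub>v u)"
      unfolding w_def using Tc Tu u
      by (simp add: mult_minus_distrib_mat_vec[OF Tc] mult_mat_vec[OF Tc])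
    also have "\<dots> = (- s) \<cdot>\<^sub>v w"
      unfolding TTu w_def using Tu u Tc by (intro eq_vecI) (auto simp: algebra_simps)
    finally have "w \<bullet> (T *\<^sub>v w) = - s * (w \<bullet> w)" using w by simp
    then have "s * (w \<bullet> w) \<le> 0" using pos[OF w] by simp
    then have "w \<bullet> w = 0"
      using s False real_scalar_prod_self_nonneg[of w] by (simp add: mult_le_0_iff)
    then have w0: "w = 0\<^sub>v n" using real_scalar_prod_self_eq_0[OF w] by simp
    show ?thesis
    proof (rule eq_vecI)
      fix i assume "i < dim_vec (s \<cdot>\<^sub>v u)"
      then show "(T *\<^sub>v u) $ i = (s \<cdot>\<^sub>v u) $ i"
        using arg_cong[OF w0, of "\<lambda>x. x $ i"] Tu u Tc unfolding w_def by simp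
    qed (use Tc u in simp)
  qed
qed

text \<open>Evaluates the definite description in \<open>mat_sqrt\<close>. The candidate is a root
  by orthogonality of \<open>U\<close>; any other root acts on each column of \<open>U\<close> by
  the same factor \<open>s i\<close>, hence agrees with it.\<close>

lemma mat_sqrt_diagonalization:
  assumes M: "psd_mat n M" and U: "U \<in> carrier_mat n n" and UU: "U\<^sup>T * U = 1\<^sub>m n"
    and MU: "M * U = U * diagonal n (\<lambda>i. s i * s i)" and s: "\<And>i. i < n \<Longrightarrow> s i \<ge> 0"
  shows "mat_sqrt M = U * diagonal n s * U\<^sup>T"
proof -
  let ?D = "diagonal n s" and ?S = "U * diagonal n s * U\<^sup>T"
  have Mc: "M \<in> carrier_mat n n" using M unfolding psd_mat_def by auto
  have UT: "U\<^sup>T \<in> carrier_mat n n" using U by simp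
  have UU': "U * U\<^sup>T = 1\<^sub>m n" by (rule mat_mult_left_right_inverse[OF UT U UU])
  have UD: "U * ?D \<in> carrier_mat n n" using U by simp
  have S: "?S \<in> carrier_mat n n" by (rule mult_carrier_mat[OF UD UT])
  \<comment> \<open>A matrix is determined by its product with the invertible \<open>U\<close>; this
    recovers both \<open>M\<close> and an arbitrary root \<open>T\<close>.\<close>
  have unique: "X = Y * U\<^sup>T" if "X \<in> carrier_mat n n" "X * U = Y" for X Y :: "real mat"
    using assoc_mult_mat[OF that(1) U UT] that UU' by simp
  have D: "?D \<in> carrier_mat n n" by simp
  have DUT: "?D * U\<^sup>T \<in> carrier_mat n n" using UT by (rule mult_carrier_mat[OF D])
  have "?S * ?S = U * (?D * ((U\<^sup>T * U) * (?D * U\<^sup>T)))"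
    unfolding assoc_mult_mat[OF U D UT] assoc_mult_mat[OF U DUT mult_carrier_mat[OF U DUT]]
      assoc_mult_mat[OF D UT mult_carrier_mat[OF U DUT]] assoc_mult_mat[OF UT U DUT] ..
  also have "\<dots> = U * ((?D * ?D) * U\<^sup>T)"
    unfolding UU left_mult_one_mat[OF DUT] assoc_mult_mat[OF D D UT] ..
  also have "\<dots> = U * diagonal n (\<lambda>i. s i * s i) * U\<^sup>T"
    unfolding diagonal_mult_diagonal by (rule assoc_mult_mat[OF U diagonal_carrier UT, symmetric])
  also have "\<dots> = M" using unique[OF Mc MU] by simp
  finally have SS: "?S * ?S = M" .
  have "?S\<^sup>T = U * (?D * U\<^sup>T)"
    unfolding transpose_mult[OF UD UT] transpose_mult[OF U D] transpose_transpose
      transpose_diagonal ..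
  then have symS: "?S\<^sup>T = ?S" unfolding assoc_mult_mat[OF U D UT] .
  have "0 \<le> x \<bullet> (?S *\<^sub>v x)" if x: "x \<in> carrier_vec n" for x
  proof -
    \<comment> \<open>These are the coordinates of \<open>x\<close> in the eigenbasis, where the
      quadratic form becomes a sum of squares weighted by the \<open>s i\<close>.\<close>
    define y where "y = U\<^sup>T *\<^sub>v x"
    have y: "y \<in> carrier_vec n" unfolding y_def using UT x by simp
    have Dy: "?D *\<^sub>v y \<in> carrier_vec n" by (rule mult_mat_vec_carrier[OF D y])
    have "x \<bullet> (?S *\<^sub>v x) = x \<bullet> (U *\<^sub>v (?D *\<^sub>v y))"
      using assoc_mult_mat_vec[OF UD UT x] assoc_mult_mat_vec[OF U D y] unfolding y_def by simp
    also have "\<dots> = y \<bullet> (?D *\<^sub>v y)"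
      unfolding y_def using transpose_vec_mult_scalar[OF U Dy x] y_def by simp
    also have "\<dots> = (\<Sum>i\<in>{0..<n}. y $ i * (s i * y $ i))"
      using y by (auto simp: scalar_prod_def if_distrib if_distribR cong: if_cong intro!: sum.cong)
    also have "\<dots> \<ge> 0" using s by (auto intro!: sum_nonneg simp: mult.left_commute[of "y $ _"])
    finally show ?thesis .
  qed
  then have psdS: "psd_mat n ?S" unfolding psd_mat_def using S symS by simp
  have "T = ?S" if T: "psd_mat n T" and TT: "T * T = M" for T
  proof -
    have Tc: "T \<in> carrier_mat n n" using T unfolding psd_mat_def by auto
    have "T * U = U * ?D"
    proof (rule mat_col_eqI)
      fix i assume "i < dim_col (U * ?D)"
      then have i: "i < n" by simp
      have u: "col U i \<in> carrier_vec n" using col_dim[of U i] U by simp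
      have "T *\<^sub>v (T *\<^sub>v col U i) = (s i * s i) \<cdot>\<^sub>v col U i"
        using assoc_mult_mat_vec[OF Tc Tc u] TT col_mult2[OF Mc U i] MU
          col_mult_diagonal[OF U i, of "\<lambda>i. s i * s i"] by simp
      then have "T *\<^sub>v col U i = s i \<cdot>\<^sub>v col U i"
        using psd_mat_square_root_eigenvector[OF T u s[OF i]] by simp
      then show "col (T * U) i = col (U * ?D) i"
        using col_mult2[OF Tc U i] col_mult_diagonal[OF U i] by simp
    qed (use Tc U in auto)
    then show ?thesis by (rule unique[OF Tc])
  qed
  then show ?thesis
    unfolding mat_sqrt_def carrier_matD(1)[OF Mc] using psdS SS by (intro the_equality) blast+
qed

section \<open>Trace norm against contractions\<close>

text \<open>One half of the duality between the trace norm and the operator norm: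
  \<open>contr\<close> bounds the operator norm of \<open>Y\<^sup>T\<close> by 1, and the right-hand
  side is the trace norm of \<open>X\<close>. Cauchy-Schwarz is applied to each diagonal term in an
  eigenbasis of \<open>X * X\<^sup>T\<close>.\<close>

theorem mat_trace_mult_contraction_le:
  fixes X Y :: "real mat"
  assumes X: "X \<in> carrier_mat n n" and Y: "Y \<in> carrier_mat n n"
    and contr: "\<And>x. x \<in> carrier_vec n \<Longrightarrow> (Y\<^sup>T *\<^sub>v x) \<bullet> (Y\<^sup>T *\<^sub>v x) \<le> x \<bullet> x"
  shows "mat_trace (X * Y\<^sup>T) \<le> mat_trace (mat_sqrt (X * X\<^sup>T))"
proof -
  let ?M = "X * X\<^sup>T"
  have XT: "X\<^sup>T \<in> carrier_mat n n" and YT: "Y\<^sup>T \<in> carrier_mat n n" using X Y by auto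
  have M: "psd_mat n ?M" by (rule psd_mat_mult_transpose[OF X])
  then have Mc: "?M \<in> carrier_mat n n" and symM: "?M\<^sup>T = ?M" unfolding psd_mat_def by auto
  obtain U d where U: "U \<in> carrier_mat n n" and UU: "U\<^sup>T * U = 1\<^sub>m n"
    and MU: "?M * U = U * diagonal n d"
    using symmetric_mat_diagonalization[OF Mc symM] by blast
  have UT: "U\<^sup>T \<in> carrier_mat n n" using U by simp
  have UU': "U * U\<^sup>T = 1\<^sub>m n" by (rule mat_mult_left_right_inverse[OF UT U UU])
  have u: "col U i \<in> carrier_vec n" if "i < n" for i using col_dim[of U i] U by simp
  \<comment> \<open>Each eigenvalue is a squared norm. Hence it is nonnegative, and its root
    \<open>s i\<close> is both a singular value of \<open>X\<close> and the norm needed for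
    Cauchy-Schwarz.\<close>
  have d: "d i = (X\<^sup>T *\<^sub>v col U i) \<bullet> (X\<^sup>T *\<^sub>v col U i)" if i: "i < n" for i
  proof -
    have "d i = col U i \<bullet> (d i \<cdot>\<^sub>v col U i)"
      unfolding scalar_prod_smult_distrib[OF u[OF i] u[OF i]] orthogonal_mat_col_self[OF U UU i]
      by simp
    also have "d i \<cdot>\<^sub>v col U i = ?M *\<^sub>v col U i"
      using MU col_mult_diagonal[OF U i, of d] col_mult2[OF Mc U i] by simp
    also have "\<dots> = X *\<^sub>v (X\<^sup>T *\<^sub>v col U i)" using X XT u[OF i] by simp
    finally show ?thesis
      using transpose_vec_mult_scalar[OF X _ u[OF i], of "X\<^sup>T *\<^sub>v col U i"] XT u[OF i] by simp
  qed
  define s where "s i = sqrt (d i)" for i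
  have d0: "d i \<ge> 0" if "i < n" for i using d[OF that] real_scalar_prod_self_nonneg by simp
  \<comment> \<open>Nothing is known about \<open>d\<close> from \<open>n\<close> on, so the
    matrices are compared and not the functions.\<close>
  have "diagonal n (\<lambda>i. s i * s i) = diagonal n d"
    using d0 by (intro eq_matI) (auto simp: s_def)
  then have sqrtM: "mat_sqrt ?M = U * diagonal n s * U\<^sup>T"
    using M U UU MU d0 by (intro mat_sqrt_diagonalization) (auto simp: s_def)
  \<comment> \<open>Inserting \<open>U * U\<^sup>T = 1\<close> and moving \<open>U\<^sup>T\<close>
    cyclically to the front expresses the trace in the eigenbasis.\<close>
  have "mat_trace (X * Y\<^sup>T) = mat_trace ((X * Y\<^sup>T) * (U * U\<^sup>T))"
    unfolding UU' using X YT by simp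
  also have "\<dots> = mat_trace ((X * (Y\<^sup>T * U)) * U\<^sup>T)"
    unfolding assoc_mult_mat[OF X YT mult_carrier_mat[OF U UT]]
      assoc_mult_mat[OF X mult_carrier_mat[OF YT U] UT] assoc_mult_mat[OF YT U UT] ..
  also have "\<dots> = mat_trace (U\<^sup>T * (X * (Y\<^sup>T * U)))"
    using X YT U UT by (intro mat_trace_mult_commute) auto
  also have "\<dots> = (\<Sum>i<n. (X\<^sup>T *\<^sub>v col U i) \<bullet> (Y\<^sup>T *\<^sub>v col U i))"
  proof -
    have YU: "Y\<^sup>T * U \<in> carrier_mat n n" and XYU: "X * (Y\<^sup>T * U) \<in> carrier_mat n n"
      using X YT U by auto
    have "(U\<^sup>T * (X * (Y\<^sup>T * U))) $$ (i, i) = (X\<^sup>T *\<^sub>v col U i) \<bullet> (Y\<^sup>T *\<^sub>v col U i)" if i: "i < n" for i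
    proof -
      have "(U\<^sup>T * (X * (Y\<^sup>T * U))) $$ (i, i) = col U i \<bullet> col (X * (Y\<^sup>T * U)) i"
        using U i XYU by simp
      also have "\<dots> = col U i \<bullet> (X *\<^sub>v (Y\<^sup>T *\<^sub>v col U i))"
        using col_mult2[OF X YU i] col_mult2[OF YT U i] by simp
      also have "\<dots> = (X\<^sup>T *\<^sub>v col U i) \<bullet> (Y\<^sup>T *\<^sub>v col U i)"
        using transpose_vec_mult_scalar[OF X _ u[OF i], of "Y\<^sup>T *\<^sub>v col U i"] YT u[OF i] by simp
      finally show ?thesis .
    qed
    then show ?thesis using U by (simp add: mat_trace_def)
  qed
  also have "\<dots> \<le> (\<Sum>i<n. s i)"
  proof (rule sum_mono)
    fix i assume "i \<in> {..<n}"
    then have i: "i < n" by simp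
    have "(X\<^sup>T *\<^sub>v col U i) \<bullet> (Y\<^sup>T *\<^sub>v col U i)
        \<le> s i * sqrt ((Y\<^sup>T *\<^sub>v col U i) \<bullet> (Y\<^sup>T *\<^sub>v col U i))"
      unfolding s_def d[OF i] using XT YT u[OF i] by (intro scalar_prod_le_norm_mult[of _ n]) auto
    also have "\<dots> \<le> s i * 1"
      using contr[OF u[OF i]] orthogonal_mat_col_self[OF U UU i] d0[OF i]
      by (intro mult_left_mono) (auto simp: s_def)
    finally show "(X\<^sup>T *\<^sub>v col U i) \<bullet> (Y\<^sup>T *\<^sub>v col U i) \<le> s i" by simp
  qed
  also have "\<dots> = mat_trace (diagonal n s)" by (simp add: mat_trace_def)
  also have "\<dots> = mat_trace (U\<^sup>T * (U * diagonal n s))"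
    using assoc_mult_mat[OF UT U diagonal_carrier[of n s]] UU by simp
  also have "\<dots> = mat_trace (mat_sqrt ?M)"
    unfolding sqrtM by (rule mat_trace_mult_commute[OF UT mult_carrier_mat[OF U diagonal_carrier]])
  finally show ?thesis .
qed

section \<open>The Schur test and normalized nonnegative matrices\<close>

text \<open>
  Rows or columns with sum \<open>0\<close> vanish identically; division by zero then yields \<open>0\<close>, as it should.
\<close>

lemma schur_test:
  fixes a :: "'i \<Rightarrow> 'j \<Rightarrow> real" and x :: "'i \<Rightarrow> real"
  assumes a: "\<And>i j. a i j \<ge> 0" and fin: "finite I" "finite J"
  defines "r \<equiv> \<lambda>i. \<Sum>j\<in>J. a i j" and "c \<equiv> \<lambda>j. \<Sum>i\<in>I. a i j"
  shows "(\<Sum>j\<in>J. (\<Sum>i\<in>I. a i j / sqrt (r i * c j) * x i)\<^sup>2) \<le> (\<Sum>i\<in>I. (x i)\<^sup>2)"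
proof -
  have r: "r i \<ge> 0" and c: "c j \<ge> 0" for i j
    unfolding r_def c_def by (simp_all add: a sum_nonneg)
  have "(\<Sum>i\<in>I. a i j / sqrt (r i * c j) * x i)\<^sup>2 \<le> (\<Sum>i\<in>I. a i j / r i * (x i)\<^sup>2)" for j
  proof -
    \<comment> \<open>The weight is split so that the squares of \<open>?f\<close> are normalized by
      the column sum, while those of \<open>?g\<close> carry the row sum, which cancels after
      summation over \<open>j\<close>.\<close>
    let ?f = "\<lambda>i. sqrt (a i j / c j)" and ?g = "\<lambda>i. sqrt (a i j / r i) * x i"
    have "(\<Sum>i\<in>I. a i j / sqrt (r i * c j) * x i) = (\<Sum>i\<in>I. ?f i * ?g i)"
      by (intro sum.cong refl) (simp add: real_sqrt_divide real_sqrt_mult a mult.left_commute mult.commute)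
    also have "\<bar>\<dots>\<bar> \<le> (\<Sum>i\<in>I. \<bar>?f i\<bar> * \<bar>?g i\<bar>)"
      by (rule order_trans[OF sum_abs]) (simp add: abs_mult)
    also have "\<dots> \<le> L2_set ?f I * L2_set ?g I"
      by (rule L2_set_mult_ineq)
    also have "\<dots> \<le> 1 * L2_set ?g I"
    proof (rule mult_right_mono)
      have "(\<Sum>i\<in>I. (?f i)\<^sup>2) = (\<Sum>i\<in>I. a i j / c j)"
        using a c by simp
      also have "\<dots> = c j / c j" by (simp only: c_def sum_divide_distrib)
      also have "\<dots> \<le> 1" by simp
      finally show "L2_set ?f I \<le> 1" by (simp add: L2_set_def)
    qed simp
    finally have "\<bar>\<Sum>i\<in>I. a i j / sqrt (r i * c j) * x i\<bar>\<^sup>2 \<le> (L2_set ?g I)\<^sup>2"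
      by (intro power_mono) auto
    then show ?thesis
      using a r by (simp add: L2_set_def sum_nonneg power_mult_distrib)
  qed
  then have "(\<Sum>j\<in>J. (\<Sum>i\<in>I. a i j / sqrt (r i * c j) * x i)\<^sup>2)
      \<le> (\<Sum>j\<in>J. \<Sum>i\<in>I. a i j / r i * (x i)\<^sup>2)"
    by (rule sum_mono)
  \<comment> \<open>Exchanging the sums collects the entries of row \<open>i\<close> into
    \<open>r i\<close>.\<close>
  also have "\<dots> = (\<Sum>i\<in>I. r i / r i * (x i)\<^sup>2)"
    unfolding r_def sum_divide_distrib sum_distrib_right by (rule sum.swap)
  also have "\<dots> \<le> (\<Sum>i\<in>I. (x i)\<^sup>2)"
    by (intro sum_mono) simp
  finally show ?thesis .
qed

text \<open>The square in the numerator is an entry of \<open>X\<close> times the unnormalized entry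
  of \<open>Y\<close>, so the left-hand side is the trace of \<open>X * Y\<^sup>T\<close>; the Schur
  test makes \<open>Y\<^sup>T\<close> a contraction.\<close>

lemma sum_normalized_le_trace_mat_sqrt:
  fixes a :: "nat \<Rightarrow> nat \<Rightarrow> real" and n :: nat
  assumes a: "\<And>i j. a i j \<ge> 0"
  defines "r \<equiv> \<lambda>i. \<Sum>j<n. a i j" and "c \<equiv> \<lambda>j. \<Sum>i<n. a i j"
    and "X \<equiv> mat n n (\<lambda>(i, j). a i j)"
  shows "(\<Sum>i<n. \<Sum>j<n. (a i j)\<^sup>2 / sqrt (r i * c j)) \<le> mat_trace (mat_sqrt (X * X\<^sup>T))"
proof -
  define Y where "Y = mat n n (\<lambda>(i, j). a i j / sqrt (r i * c j))"
  have "(\<Sum>i<n. \<Sum>j<n. (a i j)\<^sup>2 / sqrt (r i * c j)) = mat_trace (X * Y\<^sup>T)"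
    by (simp add: mat_trace_def X_def Y_def scalar_prod_def atLeast0LessThan power2_eq_square)
  also have "\<dots> \<le> mat_trace (mat_sqrt (X * X\<^sup>T))"
  proof (rule mat_trace_mult_contraction_le)
    fix x :: "real vec" assume x: "x \<in> carrier_vec n"
    then show "(Y\<^sup>T *\<^sub>v x) \<bullet> (Y\<^sup>T *\<^sub>v x) \<le> x \<bullet> x"
      using schur_test[of a "{..<n}" "{..<n}" "\<lambda>i. x $ i", OF a]
      by (simp add: Y_def r_def c_def scalar_prod_def atLeast0LessThan power2_eq_square)
  qed (auto simp: X_def Y_def)
  finally show ?thesis .
qed

section \<open>Application to digraphs: degrees as row and column sums\<close>

theorem theorem6:
  fixes G :: "'a pair_pre_digraph" and vs :: "'a list"
  assumes "pair_digraph G"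
    and "distinct vs" and "set vs = pverts G"
  shows "energy G vs \<ge> 2 * randic_index G"
proof -
  interpret pair_digraph G by fact
  let ?n = "length vs"
  let ?E = "parcs G"
  \<comment> \<open>The enumeration turns sums over matrix indices into sums over vertices.\<close>
  have bij: "bij_betw ((!) vs) {..<?n} (pverts G)"
    using assms(2,3) by (intro bij_betw_nth) auto
  have E: "?E \<subseteq> pverts G \<times> pverts G" using in_arcsD1 in_arcsD2 by auto
  have fin: "finite (pverts G)" by (rule pair_finite_verts)
  define e where "e v w = (if (v, w) \<in> ?E then 1 else 0 :: real)" for v w
  have sum_vs: "(\<Sum>i<?n. f (vs ! i)) = sum f (pverts G)" for f :: "'a \<Rightarrow> real"
    by (rule sum.reindex_bij_betw[OF bij])
  have out: "real (out_degree G v) = (\<Sum>w\<in>pverts G. e v w)" for v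
  proof -
    have "out_arcs G v = Pair v ` {w \<in> pverts G. (v, w) \<in> ?E}"
      using E by (auto simp: out_arcs_def)
    then have "out_degree G v = card {w \<in> pverts G. (v, w) \<in> ?E}"
      unfolding out_degree_def by (simp add: card_image inj_on_def)
    then show ?thesis using fin by (simp add: e_def sum.If_cases Int_def)
  qed
  have inn: "real (in_degree G w) = (\<Sum>v\<in>pverts G. e v w)" for w
  proof -
    have "in_arcs G w = (\<lambda>v. (v, w)) ` {v \<in> pverts G. (v, w) \<in> ?E}"
      using E by (auto simp: in_arcs_def)
    then have "in_degree G w = card {v \<in> pverts G. (v, w) \<in> ?E}"
      unfolding in_degree_def by (simp add: card_image inj_on_def)
    then show ?thesis using fin by (simp add: e_def sum.If_cases Int_def)
  qed
  \<comment> \<open>As \<open>e\<close> takes only the values 0 and 1, its square is again the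
    indicator of an arc. The summand thus has the shape of the matrix bound and vanishes off the
    arcs, so the sum extends to all pairs of vertices.\<close>
  let ?h = "\<lambda>v w. (e v w)\<^sup>2 / sqrt (real (out_degree G v) * real (in_degree G w))"
  have "2 * randic_index G = (\<Sum>(v, w)\<in>?E. ?h v w)"
    by (auto simp: randic_index_def e_def intro!: sum.cong)
  also have "\<dots> = (\<Sum>(v, w)\<in>pverts G \<times> pverts G. ?h v w)"
    using E fin by (intro sum.mono_neutral_left) (auto simp: e_def)
  also have "\<dots> = (\<Sum>v\<in>pverts G. \<Sum>w\<in>pverts G. ?h v w)"
    by (simp add: sum.cartesian_product)
  also have "\<dots> = (\<Sum>i<?n. \<Sum>j<?n. ?h (vs ! i) (vs ! j))"
    by (simp add: sum_vs[symmetric])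
  also have "\<dots> \<le> energy G vs"
    using sum_normalized_le_trace_mat_sqrt[of "\<lambda>i j. e (vs ! i) (vs ! j)" ?n]
    by (simp add: out inn sum_vs[symmetric] energy_def Defs.adj_mat_def e_def)
  finally show ?thesis .
qed

end
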